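(* Let $\{a_n\}_{n\ge0}$ and $\{b_n\}_{n\ge0}$ be the sequences satisfying, for all $n\ge0$, $$(n+2)^2u_{n+2}-(32n^2+96n+76)u_{n+1}+256(n+1)^2u_n=0\quad(u_n=a_n\text{ or }b_n)$$ with initial values $a_0=1$, $a_1=12$, $b_0=0$, $b_1=1$. Then $$\left|\frac{b_n}{a_n}-\frac12L(2,\chi_{-1})\right|\ll\frac1{\log n}$$ as $n\to\infty$.
   Context: $\chi_{-1}$ is the odd Dirichlet character modulo $4$ ($\chi_{-1}(n)=(-1)^{(n-1)/2}$ for odd $n$, $0$ for even $n$), and $L(s,\chi_{-1})=\sum_{n\ge1}\chi_{-1}(n)n^{-s}$. $X_n\ll Y_n$ means $|X_n|\le CY_n$ for some constant $C$ and all large $n$. *)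

theory Defs
  imports "HOL-Analysis.Analysis" "HOL-Library.Landau_Symbols"
begin

definition chi_m1 :: "nat \<Rightarrow> real" where
  "chi_m1 n = (if odd n then (-1) ^ ((n - 1) div 2) else 0)"

text \<open>
  The sum starts at \<open>n = 1\<close>, hence the shift by \<open>Suc\<close>. For a non-principal
  character the natural order of summation gives the right value for all real \<open>s > 0\<close>, including
  the range where convergence is only conditional.
\<close>
definition dirichlet_L :: "real \<Rightarrow> (nat \<Rightarrow> real) \<Rightarrow> real" where
  "dirichlet_L s f = (\<Sum>n. f (Suc n) * real (Suc n) powr (-s))"

definition apery_like_rec :: "(nat \<Rightarrow> real) \<Rightarrow> bool" where
  "apery_like_rec u \<longleftrightarrow>
     (\<forall>n. (real n + 2)\<^sup>2 * u (n + 2)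
          - (32 * (real n)\<^sup>2 + 96 * real n + 76) * u (n + 1)
          + 256 * (real n + 1)\<^sup>2 * u n = 0)"

end

theory Submission
  imports Defs
begin

text \<open>
  A generic solution of the recurrence behaves like $16^n\log n/\sqrt n$ and a recessive one like
  $16^n/\sqrt n$. With
  $M(x)=\int_0^1(1-k^2)^{x-1}K(k)\,dk$, where $K$ is the complete elliptic integral, a recessive
  solution is $q_n=\frac14 16^nM(n+1)$. Indeed, expanding $K$ gives $M$ as a series of Beta values
  whose terms satisfy a three-term relation in $x$ up to a difference in the summation index; the
  boundary value vanishes for $x>0$, which is the recurrence, while at $x=0$ Wallis' product
  evaluates it and gives $q_1=12q_0-1$. Moreover
  $q_0=\frac14\int_0^{\pi/2}\theta/\sin\theta\,d\theta=\frac12L(2,\chi_{-1})$, so comparison of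
  initial values yields $b_n=\frac12L(2,\chi_{-1})a_n-q_n$. Since $q_n\le\frac34 16^n/\sqrt{n+1}$, the
  Casoratian of $a_n$ and $q_n$ shows that $a_n/q_n$ grows by at least $\frac19\frac1{n+1}$ at each
  step, hence $a_n/q_n\ge\frac19\log n$.
\<close>

subsection \<open>Wallis ratios and the Beta function\<close>

text \<open>By the Legendre duplication formula this is $4^{-j}\binom{2j}{j}$.\<close>
definition wallis_ratio :: "nat \<Rightarrow> real" where
  "wallis_ratio j = pochhammer (1 / 2) j / fact j"

lemma wallis_ratio_0 [simp]: "wallis_ratio 0 = 1"
  by (simp add: wallis_ratio_def)

lemma wallis_ratio_Suc:
  "wallis_ratio (Suc j) = wallis_ratio j * ((2 * real j + 1) / (2 * real j + 2))"
  by (simp add: wallis_ratio_def pochhammer_Suc field_simps)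

lemma wallis_ratio_pos: "wallis_ratio j > 0"
  by (simp add: wallis_ratio_def pochhammer_pos)

lemma Beta_real_pos:
  fixes x y :: real
  assumes "x > 0" and "y > 0"
  shows "Beta x y > 0"
  using assms by (simp add: Beta_def)

lemma pos_notin_nonpos_Ints:
  fixes x :: "'a :: linordered_idom"
  shows "x > 0 \<Longrightarrow> x \<notin> \<int>\<^sub>\<le>\<^sub>0"
  using nonpos_Ints_nonpos[of x] by auto

lemma Beta_real_plus1_left:
  fixes x y :: real
  assumes "x > 0" and "y > 0"
  shows "Beta (x + 1) y = x / (x + y) * Beta x y"
  using Beta_plus1_left[of x y] assms by (simp add: pos_notin_nonpos_Ints field_simps)

lemma Beta_real_1_left:
  fixes y :: real
  assumes "y > 0"
  shows "Beta 1 y = 1 / y"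
  using Gamma_plus1[of y] assms
  by (simp add: Beta_def Gamma_eq_zero_iff pos_notin_nonpos_Ints add.commute)

lemma Beta_half_eq_wallis_ratio: "Beta (real j + 1 / 2) (1 / 2) = pi * wallis_ratio j"
proof -
  have "Gamma (real j + 1 / 2) = sqrt pi * pochhammer (1 / 2) j"
    using pochhammer_Gamma[of "1 / 2 :: real" j]
    by (simp add: pos_notin_nonpos_Ints Gamma_one_half_real add_ac)
  then show ?thesis
    by (simp add: Beta_def wallis_ratio_def Gamma_one_half_real Gamma_fact add_ac)
qed

lemma mult_Beta_half_square_le:
  fixes x :: real
  assumes "x > 0"
  shows "(x + real n) * (Beta (x + real n) (1 / 2))\<^sup>2 \<le> x * (Beta x (1 / 2))\<^sup>2"
proof (induction n)
  case (Suc n)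
  define y where "y = x + real n"
  have y: "y > 0" using assms by (simp add: y_def)
  have "(y + 1) * (Beta (y + 1) (1 / 2))\<^sup>2
      = (y + 1) * y / (y + 1 / 2)\<^sup>2 * (y * (Beta y (1 / 2))\<^sup>2)"
    using y by (simp add: Beta_real_plus1_left power_mult_distrib power_divide power2_eq_square)
  also have "\<dots> \<le> 1 * (y * (Beta y (1 / 2))\<^sup>2)"
  proof (rule mult_right_mono)
    have "(y + 1) * y \<le> (y + 1 / 2)\<^sup>2"
      by (simp add: power2_eq_square algebra_simps)
    then show "(y + 1) * y / (y + 1 / 2)\<^sup>2 \<le> 1"
      using y by (simp add: divide_le_eq_1)
  qed (use y in simp)
  also have "\<dots> \<le> x * (Beta x (1 / 2))\<^sup>2"
    using Suc.IH by (simp add: y_def)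
  finally show ?case by (simp add: y_def add_ac)
qed simp

lemma wallis_ratio_square_le: "(wallis_ratio j)\<^sup>2 \<le> 1 / (2 * real j + 1)"
proof -
  have "(1 / 2 + real j) * (pi * wallis_ratio j)\<^sup>2 \<le> 1 / 2 * pi\<^sup>2"
    using mult_Beta_half_square_le[of "1 / 2" j] Beta_half_eq_wallis_ratio[of 0]
      Beta_half_eq_wallis_ratio[of j]
    by (simp add: add_ac)
  then have "pi\<^sup>2 * ((2 * real j + 1) * (wallis_ratio j)\<^sup>2) \<le> pi\<^sup>2 * 1"
    by (simp add: power_mult_distrib algebra_simps)
  then have "(2 * real j + 1) * (wallis_ratio j)\<^sup>2 \<le> 1"
    by (simp only: mult_le_cancel_left_pos zero_less_power pi_gt_zero)
  then show ?thesis by (simp add: field_simps)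
qed

lemma Beta_half_le: "Beta (real n + 1) (1 / 2) \<le> 2 / sqrt (real n + 1)"
proof (rule power2_le_imp_le)
  show "(Beta (real n + 1) (1 / 2))\<^sup>2 \<le> (2 / sqrt (real n + 1))\<^sup>2"
    using mult_Beta_half_square_le[of 1 n] by (simp add: Beta_real_1_left power_divide field_simps)
qed simp

lemma wallis_ratio_square_tendsto:
  "(\<lambda>j. (wallis_ratio j)\<^sup>2 * (2 * real j + 1)) \<longlonglongrightarrow> 2 / pi"
proof -
  have "(\<Prod>k=1..j. (4 * real k ^ 2) / (4 * real k ^ 2 - 1))
      = inverse ((wallis_ratio j)\<^sup>2 * (2 * real j + 1))" for j
  proof (induction j)
    case (Suc j)
    have "4 * (real (Suc j))\<^sup>2 - 1 = (2 * real j + 1) * (2 * real j + 3)"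
      "(2 * real j + 2)\<^sup>2 = 4 * (real (Suc j))\<^sup>2"
      by (simp_all add: power2_eq_square algebra_simps)
    then show ?case
      using Suc.IH wallis_ratio_pos[of j]
      by (simp add: wallis_ratio_Suc power_mult_distrib power_divide field_simps)
        (simp add: power2_eq_square algebra_simps)
  qed simp
  with wallis have "(\<lambda>j. inverse ((wallis_ratio j)\<^sup>2 * (2 * real j + 1))) \<longlonglongrightarrow> pi / 2"
    by simp
  from tendsto_inverse[OF this] show ?thesis by simp
qed

lemma Beta_of_nat_add_tendsto_0:
  fixes x y :: real
  assumes "x > 0" and "y > 0"
  shows "(\<lambda>n. Beta x (real n + y)) \<longlonglongrightarrow> 0"
proof -
  have not_pole: "y \<notin> \<int>\<^sub>\<le>\<^sub>0" "x + y \<notin> \<int>\<^sub>\<le>\<^sub>0"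
    using assms by (simp_all add: pos_notin_nonpos_Ints)
  have "(\<lambda>n. Beta x y * (Gamma_series' (x + y) n / Gamma_series' y n * real n powr (- x)))
      \<longlonglongrightarrow> Beta x y * (Gamma (x + y) / Gamma y * 0)"
    using assms
    by (intro tendsto_intros Gamma_series'_LIMSEQ
        tendsto_neg_powr filterlim_real_sequentially)
      (simp_all add: Gamma_eq_zero_iff not_pole)
  moreover have "\<forall>\<^sub>F n in sequentially. Beta x y * (Gamma_series' (x + y) n / Gamma_series' y n
      * real n powr (- x)) = Beta x (real n + y)"
    using eventually_gt_at_top[of 0]
  proof eventually_elim
    case (elim n)
    have "Gamma_series' (x + y) n / Gamma_series' y n * real n powr (- x)
        = pochhammer y n / pochhammer (x + y) n"
      using elim by (simp add: Gamma_series'_def powr_def exp_add[symmetric] exp_minus field_simps)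
    then show ?case
      using assms by (simp add: pochhammer_Gamma not_pole Gamma_eq_zero_iff Beta_def add_ac)
  qed
  ultimately show ?thesis
    by (simp add: tendsto_cong)
qed

lemma Beta_plus1_sums:
  fixes x y :: real
  assumes "x > 0" and "y > 0"
  shows "(\<lambda>n. Beta (x + 1) (real n + y)) sums Beta x y"
proof -
  have "Beta (x + 1) (real n + y) = Beta x (real n + y) - Beta x (real (Suc n) + y)" for n
    using Beta_plus1_plus1[of x "real n + y"] assms
    by (simp add: pos_notin_nonpos_Ints algebra_simps)
  then show ?thesis
    using telescope_sums'[OF Beta_of_nat_add_tendsto_0[OF assms]] by simp
qed

subsection \<open>Moments of the complete elliptic integral\<close>

text \<open>
  Since $K(k)=\frac\pi2\sum_jc_j^2k^{2j}$ with $c_j$ the Wallis ratio, \<open>elliptic_moment x\<close> is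
  $\int_0^1(1-k^2)^{x-1}K(k)\,dk$, integrated term by term.
\<close>
definition elliptic_moment_term :: "real \<Rightarrow> nat \<Rightarrow> real" where
  "elliptic_moment_term x j = pi / 4 * (wallis_ratio j)\<^sup>2 * Beta x (real j + 1 / 2)"

definition elliptic_moment :: "real \<Rightarrow> real" where
  "elliptic_moment x = (\<Sum>j. elliptic_moment_term x j)"

lemma elliptic_moment_term_pos:
  assumes "x > 0"
  shows "elliptic_moment_term x j > 0"
  using assms wallis_ratio_pos[of j] by (simp add: elliptic_moment_term_def Beta_real_pos)

lemma elliptic_moment_term_le:
  assumes "x > 0"
  shows "elliptic_moment_term x j \<le> pi / 4 * (1 + 1 / (2 * x)) * Beta (x + 1) (real j + 1 / 2)"
proof -
  define y where "y = real j + 1 / 2"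
  have y: "y \<ge> 1 / 2" by (simp add: y_def)
  have "(wallis_ratio j)\<^sup>2 * Beta x y \<le> 1 / (2 * y) * Beta x y"
    using wallis_ratio_square_le[of j] Beta_real_pos[of x y] assms y
    by (intro mult_right_mono) (simp_all add: y_def algebra_simps)
  also have "\<dots> = (1 / (2 * x) + 1 / (2 * y)) * Beta (x + 1) y"
  proof -
    have "Beta (x + 1) y = x / (x + y) * Beta x y"
      using assms y by (intro Beta_real_plus1_left) auto
    moreover have "1 / (2 * x) + 1 / (2 * y) = 1 / (2 * y) * ((x + y) / x)"
      using assms y by (simp add: field_simps)
    ultimately show ?thesis
      using assms y by simp
  qed
  also have "\<dots> \<le> (1 + 1 / (2 * x)) * Beta (x + 1) y"
    using assms y Beta_real_pos[of "x + 1" y] by (intro mult_right_mono) (simp_all add: field_simps)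
  finally show ?thesis
    by (simp add: elliptic_moment_term_def y_def mult.assoc)
qed

lemma elliptic_moment_term_sums:
  assumes "x > 0"
  shows "elliptic_moment_term x sums elliptic_moment x"
  unfolding elliptic_moment_def
proof (rule summable_sums, rule summable_comparison_test')
  show "summable (\<lambda>j. pi / 4 * (1 + 1 / (2 * x)) * Beta (x + 1) (real j + 1 / 2))"
    by (intro summable_mult sums_summable[OF Beta_plus1_sums] assms) simp
  show "norm (elliptic_moment_term x j) \<le> pi / 4 * (1 + 1 / (2 * x)) * Beta (x + 1) (real j + 1 / 2)" for j
    using elliptic_moment_term_le[OF assms] elliptic_moment_term_pos[OF assms, of j] by simp
qed

lemma elliptic_moment_pos:
  assumes "x > 0"
  shows "elliptic_moment x > 0"
  unfolding elliptic_moment_def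
  by (intro suminf_pos sums_summable[OF elliptic_moment_term_sums] elliptic_moment_term_pos assms)

lemma elliptic_moment_le:
  assumes "x > 0"
  shows "elliptic_moment x \<le> pi / 4 * (1 + 1 / (2 * x)) * Beta x (1 / 2)"
  by (rule sums_le[OF elliptic_moment_term_le[OF assms] elliptic_moment_term_sums[OF assms]
        sums_mult[OF Beta_plus1_sums[OF assms]]]) simp

lemma elliptic_moment_term_plus1:
  assumes "x > 0"
  shows "(x + real j + 1 / 2) * elliptic_moment_term (x + 1) j = x * elliptic_moment_term x j"
proof -
  have "(x + real j + 1 / 2) * Beta (x + 1) (real j + 1 / 2) = x * Beta x (real j + 1 / 2)"
    using Beta_plus1_left[of x "real j + 1 / 2"] assms
    by (simp add: pos_notin_nonpos_Ints add.assoc)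
  then show ?thesis
    unfolding elliptic_moment_term_def by (metis mult.left_commute)
qed

lemma elliptic_moment_term_Suc:
  "(x + real j + 1 / 2) * ((real (Suc j))\<^sup>2 * elliptic_moment_term x (Suc j))
    = (real j + 1 / 2) ^ 3 * elliptic_moment_term x j"
proof -
  let ?y = "real j + 1 / 2"
  have ratio: "(real (Suc j))\<^sup>2 * (wallis_ratio (Suc j))\<^sup>2 = ?y\<^sup>2 * (wallis_ratio j)\<^sup>2"
  proof -
    have "real (Suc j) * wallis_ratio (Suc j) = ?y * wallis_ratio j"
      by (simp add: wallis_ratio_Suc field_simps)
    then show ?thesis by (simp only: flip: power_mult_distrib)
  qed
  have beta: "(x + ?y) * Beta x (?y + 1) = ?y * Beta x ?y"
    by (intro Beta_plus1_right pos_notin_nonpos_Ints) simp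
  have "(x + real j + 1 / 2) * ((real (Suc j))\<^sup>2 * elliptic_moment_term x (Suc j))
      = pi / 4 * ((real (Suc j))\<^sup>2 * (wallis_ratio (Suc j))\<^sup>2) * ((x + ?y) * Beta x (?y + 1))"
    by (simp add: elliptic_moment_term_def add_ac mult_ac)
  also have "\<dots> = ?y ^ 3 * elliptic_moment_term x j"
    unfolding ratio beta elliptic_moment_term_def
    by (simp only: power3_eq_cube power2_eq_square mult_ac)
  finally show ?thesis .
qed

definition elliptic_moment_op :: "(real \<Rightarrow> real) \<Rightarrow> real \<Rightarrow> real" where
  "elliptic_moment_op f x = (x + 1)\<^sup>2 * f (x + 2) - (2 * x\<^sup>2 + 2 * x + 3 / 4) * f (x + 1) + x\<^sup>2 * f x"

text \<open>
  Over the common denominator this is $a^3+b^3=(a+b)(a^2-ab+b^2)$ with $a=x+1$ and $b=j+\frac12$.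
\<close>
lemma elliptic_moment_term_telescope:
  assumes "x \<ge> 0"
  shows "elliptic_moment_op (\<lambda>x. elliptic_moment_term x j) x
    = (real j)\<^sup>2 * elliptic_moment_term (x + 1) j
      - (real (Suc j))\<^sup>2 * elliptic_moment_term (x + 1) (Suc j)"
    (is "?lhs = ?rhs")
proof -
  define a b t where "a = x + 1" and "b = real j + 1 / 2" and "t = elliptic_moment_term (x + 1) j"
  note defs = this
  have t_raised: "(a + b) * elliptic_moment_term (x + 2) j = a * t"
    using elliptic_moment_term_plus1[of "x + 1" j] assms by (simp add: defs add_ac)
  have t_lowered: "x\<^sup>2 * elliptic_moment_term x j = (a - 1) * (a + b - 1) * t"
  proof (cases "x = 0")
    case False
    then have "x * elliptic_moment_term x j = (a + b - 1) * t"
      using elliptic_moment_term_plus1[of x j] assms by (simp add: defs add_ac)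
    then show ?thesis by (simp add: defs(1) power2_eq_square mult.assoc)
  qed (simp add: defs)
  have t_Suc: "(a + b) * ((real (Suc j))\<^sup>2 * elliptic_moment_term (x + 1) (Suc j)) = b ^ 3 * t"
    using elliptic_moment_term_Suc[of "x + 1" j] by (simp only: defs add.assoc)
  have "(a + b) * ?lhs = (a + b) * ?rhs"
    using t_raised t_lowered t_Suc defs(1,2)
    unfolding elliptic_moment_op_def defs(3)[symmetric] by algebra
  moreover have "a + b \<noteq> 0"
    using assms by (simp add: defs(1,2))
  ultimately show ?thesis
    by simp
qed

lemma elliptic_moment_op_eq_boundary:
  assumes "x \<ge> 0" and boundary: "(\<lambda>j. (real j)\<^sup>2 * elliptic_moment_term (x + 1) j) \<longlonglongrightarrow> l"
  shows "elliptic_moment_op elliptic_moment x = - l"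
proof -
  have "(\<lambda>j. x\<^sup>2 * elliptic_moment_term x j) sums (x\<^sup>2 * elliptic_moment x)"
    using assms(1) by (cases "x = 0") (auto intro!: sums_mult elliptic_moment_term_sums)
  then have "(\<lambda>j. elliptic_moment_op (\<lambda>x. elliptic_moment_term x j) x)
      sums elliptic_moment_op elliptic_moment x"
    unfolding elliptic_moment_op_def using assms(1)
    by (intro sums_add sums_diff) (auto intro!: sums_mult elliptic_moment_term_sums)
  moreover have "(\<lambda>j. elliptic_moment_op (\<lambda>x. elliptic_moment_term x j) x) sums (- l)"
    using telescope_sums'[OF boundary] unfolding elliptic_moment_term_telescope[OF assms(1)] by simp
  ultimately show ?thesis by (rule sums_unique2)
qed

lemma elliptic_moment_op_eq_0:
  assumes "x > 0"
  shows "elliptic_moment_op elliptic_moment x = 0"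
proof -
  have "(\<lambda>j. (real j)\<^sup>2 * elliptic_moment_term (x + 1) j) \<longlonglongrightarrow> 0"
  proof (rule tendsto_sandwich[OF _ _ tendsto_const])
    show "(\<lambda>j. pi / 4 * (x * Beta x (real j + 1 / 2))) \<longlonglongrightarrow> 0"
      using assms by (intro tendsto_mult_right_zero Beta_of_nat_add_tendsto_0) auto
    have "(real j)\<^sup>2 * elliptic_moment_term (x + 1) j \<le> pi / 4 * (x * Beta x (real j + 1 / 2))" for j
    proof -
      have "real j * (wallis_ratio j)\<^sup>2 \<le> real j * (1 / (2 * real j + 1))"
        by (intro mult_left_mono wallis_ratio_square_le) simp
      also have "\<dots> \<le> 1" by simp
      finally have "real j * (real j * (wallis_ratio j)\<^sup>2 * Beta (x + 1) (real j + 1 / 2))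
          \<le> (x + real j + 1 / 2) * (1 * Beta (x + 1) (real j + 1 / 2))"
        using assms by (intro mult_mono) (auto simp: Beta_real_pos less_imp_le)
      also have "\<dots> = x * Beta x (real j + 1 / 2)"
        using Beta_plus1_left[of x "real j + 1 / 2"] assms
        by (simp add: pos_notin_nonpos_Ints add_ac)
      finally show ?thesis
        by (simp add: elliptic_moment_term_def power2_eq_square mult_ac)
    qed
    then show "\<forall>\<^sub>F j in sequentially.
        (real j)\<^sup>2 * elliptic_moment_term (x + 1) j \<le> pi / 4 * (x * Beta x (real j + 1 / 2))"
      by simp
    show "\<forall>\<^sub>F j in sequentially. 0 \<le> (real j)\<^sup>2 * elliptic_moment_term (x + 1) j"
      using assms by (simp add: elliptic_moment_term_pos less_imp_le)
  qed
  from elliptic_moment_op_eq_boundary[OF _ this] assms show ?thesis by simp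
qed

lemma elliptic_moment_2: "elliptic_moment 2 = 3 / 4 * elliptic_moment 1 - 1 / 4"
proof -
  have "(\<lambda>j. pi / 8 * ((wallis_ratio j)\<^sup>2 * (2 * real j + 1)) * (1 - Beta 1 (real j + 1 / 2) / 2)\<^sup>2)
      \<longlonglongrightarrow> pi / 8 * (2 / pi) * (1 - 0 / 2)\<^sup>2"
    by (intro tendsto_intros wallis_ratio_square_tendsto Beta_of_nat_add_tendsto_0) simp_all
  moreover have "pi / 8 * ((wallis_ratio j)\<^sup>2 * (2 * real j + 1)) * (1 - Beta 1 (real j + 1 / 2) / 2)\<^sup>2
      = (real j)\<^sup>2 * elliptic_moment_term 1 j" for j
  proof -
    have beta: "Beta 1 (real j + 1 / 2) = 2 / (2 * real j + 1)"
      by (simp add: Beta_real_1_left field_simps)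
    then have "1 - Beta 1 (real j + 1 / 2) / 2 = 2 * real j / (2 * real j + 1)"
      by (simp add: field_simps)
    then show ?thesis
      using beta by (simp add: elliptic_moment_term_def add.commute power2_eq_square)
  qed
  ultimately have "(\<lambda>j. (real j)\<^sup>2 * elliptic_moment_term (0 + 1) j) \<longlonglongrightarrow> 1 / 4"
    by simp
  from elliptic_moment_op_eq_boundary[OF _ this] show ?thesis
    by (simp add: elliptic_moment_op_def)
qed

subsection \<open>The first moment and the value $L(2,\chi_{-1})$\<close>

lemma has_integral_sin_power:
  "((\<lambda>t. sin t ^ (2 * j)) has_integral (pi / 2 * wallis_ratio j)) {0..pi / 2}"
proof (induction j)
  case 0
  show ?case using has_integral_const_real[of "1::real" 0 "pi / 2"] by simp
next
  case (Suc j)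
  let ?F = "\<lambda>t::real. sin t ^ (2 * j + 1) * cos t"
  let ?f = "\<lambda>t::real. (2 * real j + 1) * sin t ^ (2 * j) - (2 * real j + 2) * sin t ^ (2 * Suc j)"
  have "(?F has_real_derivative ?f t) (at t)" for t
  proof -
    have "(?F has_real_derivative
        (2 * real j + 1) * sin t ^ (2 * j) * (cos t)\<^sup>2 - sin t ^ (2 * Suc j)) (at t)"
      by (rule DERIV_cong[OF DERIV_mult[OF DERIV_power[OF DERIV_sin] DERIV_cos]])
        (simp add: power2_eq_square algebra_simps)
    then show ?thesis
      unfolding cos_squared_eq by (simp add: power2_eq_square algebra_simps)
  qed
  then have "(?f has_integral ?F (pi / 2) - ?F 0) {0..pi / 2}"
    by (intro fundamental_theorem_of_calculus)
      (auto simp flip: has_real_derivative_iff_has_vector_derivative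
        intro: has_field_derivative_at_within)
  then have "(?f has_integral 0) {0..pi / 2}" by simp
  then have "((\<lambda>t. ((2 * real j + 1) * sin t ^ (2 * j) - ?f t) / (2 * real j + 2)) has_integral
      ((2 * real j + 1) * (pi / 2 * wallis_ratio j) - 0) / (2 * real j + 2)) {0..pi / 2}"
    by (intro has_integral_divide has_integral_diff has_integral_mult_right Suc.IH)
  then show ?case by (simp add: wallis_ratio_Suc mult_ac)
qed

lemma DERIV_odd_power_series:
  fixes p :: "nat \<Rightarrow> real"
  assumes summable: "\<And>y. \<bar>y\<bar> < R \<Longrightarrow> summable (\<lambda>j. p j * y ^ (2 * j))" and x: "\<bar>x\<bar> < R"
  shows "((\<lambda>x. \<Sum>j. p j / (2 * real j + 1) * x ^ (2 * j + 1))
    has_real_derivative (\<Sum>j. p j * x ^ (2 * j))) (at x)"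
proof -
  define f :: "nat \<Rightarrow> real" where "f n = (if even n then p (n div 2) / real (Suc n) else 0)" for n
  have double_mono: "strict_mono (\<lambda>j::nat. 2 * j)" by (simp add: strict_mono_def)
  have not_double: "odd n" if "n \<notin> range (\<lambda>j::nat. 2 * j)" for n
    using that by (auto elim!: evenE)
  have antideriv: "(\<Sum>n. f n * y ^ Suc n) = (\<Sum>j. p j / (2 * real j + 1) * y ^ (2 * j + 1))" for y
    by (subst suminf_mono_reindex[OF double_mono, symmetric])
      (auto simp: f_def add_ac dest: not_double)
  have deriv: "(\<lambda>n. f n * real (Suc n) * y ^ n) sums c \<longleftrightarrow> (\<lambda>j. p j * y ^ (2 * j)) sums c" for y c
    by (subst sums_mono_reindex[OF double_mono, symmetric])
      (auto simp: f_def dest: not_double simp del: of_nat_Suc)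
  have "((\<lambda>x. \<Sum>n. f n * x ^ Suc n) has_real_derivative (\<Sum>n. f n * real (Suc n) * x ^ n)) (at x)"
  proof (rule DERIV_power_series')
    show "summable (\<lambda>n. f n * real (Suc n) * y ^ n)" if "y \<in> {-R<..<R}" for y
      using summable[of y] that unfolding summable_def deriv by auto
  qed (use x in auto)
  then show ?thesis
    unfolding antideriv suminf_def deriv .
qed

lemma wallis_ratio_power_series_sums:
  assumes "\<bar>x\<bar> < 1"
  shows "(\<lambda>j. wallis_ratio j * x ^ (2 * j)) sums (1 / sqrt (1 - x\<^sup>2))"
proof -
  have square_less: "x\<^sup>2 < 1" using assms by (simp add: abs_square_less_1)
  then have "(\<lambda>j. (- 1 / 2 gchoose j) * (- (x\<^sup>2)) ^ j) sums (1 + - (x\<^sup>2)) powr (- 1 / 2)"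
    by (intro gen_binomial_real) simp
  moreover have "(- 1 / 2 gchoose j) * (- (x\<^sup>2)) ^ j = wallis_ratio j * x ^ (2 * j)" for j
    by (simp add: gbinomial_pochhammer wallis_ratio_def power_minus[of "x\<^sup>2"] power_mult)
  moreover have "(1 + - (x\<^sup>2)) powr (- 1 / 2) = 1 / sqrt (1 - x\<^sup>2)"
    using square_less by (simp add: powr_minus powr_half_sqrt inverse_eq_divide)
  ultimately show ?thesis by simp
qed

lemma arcsin_sums:
  assumes "\<bar>x\<bar> < 1"
  shows "(\<lambda>j. wallis_ratio j / (2 * real j + 1) * x ^ (2 * j + 1)) sums arcsin x"
proof -
  define A where "A x = (\<Sum>j. wallis_ratio j / (2 * real j + 1) * x ^ (2 * j + 1))" for x
  have "((\<lambda>y. A y - arcsin y) has_real_derivative 0) (at y)" if "\<bar>y\<bar> < 1" for y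
  proof -
    have "(A has_real_derivative (\<Sum>j. wallis_ratio j * y ^ (2 * j))) (at y)"
      unfolding A_def
      by (rule DERIV_odd_power_series[OF sums_summable[OF wallis_ratio_power_series_sums] that])
    moreover have "(\<Sum>j. wallis_ratio j * y ^ (2 * j)) = inverse (sqrt (1 - y\<^sup>2))"
      using sums_unique[OF wallis_ratio_power_series_sums[OF that]] by (simp add: inverse_eq_divide)
    moreover have "(arcsin has_real_derivative inverse (sqrt (1 - y\<^sup>2))) (at y)"
      using that by (intro DERIV_arcsin) auto
    ultimately show ?thesis
      using DERIV_diff by fastforce
  qed
  then have "A x - arcsin x = A 0 - arcsin 0"
    using assms by (intro DERIV_isconst3[of "-1" 1]) auto
  then have "A x = arcsin x" by (simp add: A_def)
  moreover have "summable (\<lambda>j. wallis_ratio j / (2 * real j + 1) * x ^ (2 * j + 1))"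
  proof (rule summable_comparison_test')
    show "summable (\<lambda>j. wallis_ratio j * \<bar>x\<bar> ^ (2 * j))"
      using assms by (intro sums_summable[OF wallis_ratio_power_series_sums]) simp
    show "norm (wallis_ratio j / (2 * real j + 1) * x ^ (2 * j + 1))
        \<le> wallis_ratio j * \<bar>x\<bar> ^ (2 * j)" for j
    proof -
      have "wallis_ratio j * \<bar>x\<bar> ^ (2 * j) * (\<bar>x\<bar> / (2 * real j + 1))
          \<le> wallis_ratio j * \<bar>x\<bar> ^ (2 * j) * 1"
        using assms wallis_ratio_pos[of j] by (intro mult_left_mono) (auto simp: field_simps)
      then show ?thesis
        using wallis_ratio_pos[of j] by (simp add: abs_mult power_abs mult_ac)
    qed
  qed
  ultimately show ?thesis
    unfolding A_def by (simp add: sums_iff)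
qed

lemma has_integral_sums_nonneg:
  fixes f :: "nat \<Rightarrow> 'a::euclidean_space \<Rightarrow> real"
  assumes integral: "\<And>j. (f j has_integral I j) S" and "\<And>j x. x \<in> S \<Longrightarrow> 0 \<le> f j x"
    and "\<And>x. x \<in> S \<Longrightarrow> (\<lambda>j. f j x) sums g x" and "I sums J"
  shows "(g has_integral J) S"
proof (rule has_integral_monotone_convergence_increasing)
  show "((\<lambda>x. \<Sum>j<n. f j x) has_integral (\<Sum>j<n. I j)) S" for n
    by (intro has_integral_sum integral) simp
qed (use assms in \<open>auto simp: sums_def\<close>)

lemma has_integral_div_sin_elliptic_moment:
  "((\<lambda>t. t / sin t) has_integral elliptic_moment 1) {0<..<pi / 2}"
proof (rule has_integral_sums_nonneg[OF _ _ _ elliptic_moment_term_sums])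
  fix j
  have "((\<lambda>t. wallis_ratio j / (2 * real j + 1) * sin t ^ (2 * j)) has_integral
      wallis_ratio j / (2 * real j + 1) * (pi / 2 * wallis_ratio j)) {0<..<pi / 2}"
    using has_integral_sin_power unfolding has_integral_Icc_iff_Ioo by (rule has_integral_mult_right)
  also have "wallis_ratio j / (2 * real j + 1) * (pi / 2 * wallis_ratio j) = elliptic_moment_term 1 j"
    by (simp add: elliptic_moment_term_def Beta_real_1_left power2_eq_square field_simps)
  finally show "((\<lambda>t. wallis_ratio j / (2 * real j + 1) * sin t ^ (2 * j)) has_integral
      elliptic_moment_term 1 j) {0<..<pi / 2}" .
next
  fix j and t :: real
  show "0 \<le> wallis_ratio j / (2 * real j + 1) * sin t ^ (2 * j)"
    using wallis_ratio_pos[of j] by (simp add: power_mult)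
next
  fix t :: real assume "t \<in> {0<..<pi / 2}"
  then have t: "0 < t" "t < pi / 2" by auto
  then have sin_bounds: "0 < sin t" "sin t < 1"
    using sin_gt_zero[of t] sin_monotone_2pi[of t "pi / 2"] by auto
  then have "(\<lambda>j. wallis_ratio j / (2 * real j + 1) * sin t ^ (2 * j + 1) / sin t)
      sums (arcsin (sin t) / sin t)"
    by (intro sums_divide arcsin_sums) simp
  then show "(\<lambda>j. wallis_ratio j / (2 * real j + 1) * sin t ^ (2 * j)) sums (t / sin t)"
    using t sin_bounds by (simp add: arcsin_sin)
qed simp

definition inverse_tangent_integral :: "real \<Rightarrow> real" where
  "inverse_tangent_integral x = (\<Sum>k. (-1) ^ k / (2 * real k + 1)\<^sup>2 * x ^ (2 * k + 1))"

lemma arctan_div_sums: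
  assumes "x \<noteq> 0" "\<bar>x\<bar> \<le> 1"
  shows "(\<lambda>k. (-1) ^ k / (2 * real k + 1) * x ^ (2 * k)) sums (arctan x / x)"
proof -
  have "(\<lambda>k. (-1) ^ k * (1 / real (k * 2 + 1) * x ^ (k * 2 + 1)) / x) sums (arctan x / x)"
    unfolding arctan_series[OF assms(2)]
    by (intro sums_divide summable_sums summable_arctan_series assms)
  then show ?thesis
    using assms(1) by (simp add: mult_ac add_ac)
qed

lemma DERIV_inverse_tangent_integral:
  assumes "x \<noteq> 0" "\<bar>x\<bar> < 1"
  shows "(inverse_tangent_integral has_real_derivative arctan x / x) (at x)"
proof -
  have "summable (\<lambda>k. (-1) ^ k / (2 * real k + 1) * y ^ (2 * k))" if "\<bar>y\<bar> < 1" for y :: real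
    using that sums_summable[OF arctan_div_sums[of y]]
      summable_zero_power'[of "\<lambda>k. (-1) ^ k / (2 * real k + 1)"]
    by (cases "y = 0") (auto simp: power_mult)
  from DERIV_odd_power_series[OF this assms(2)]
  have "(inverse_tangent_integral has_real_derivative
      (\<Sum>k. (-1) ^ k / (2 * real k + 1) * x ^ (2 * k))) (at x)"
    unfolding inverse_tangent_integral_def by (simp add: power2_eq_square)
  then show ?thesis
    using sums_unique[OF arctan_div_sums[of x]] assms by simp
qed

lemma continuous_on_inverse_tangent_integral: "continuous_on {-1..1} inverse_tangent_integral"
  unfolding inverse_tangent_integral_def
proof (rule uniform_limit_theorem[OF _ Weierstrass_m_test])
  show "summable (\<lambda>k. inverse (real (Suc k) ^ 2))"
    using inverse_power_summable[of 2, where 'a = real] by (subst summable_Suc_iff) simp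
  fix k and x :: real assume x: "x \<in> {-1..1}"
  have "norm ((-1) ^ k / (2 * real k + 1)\<^sup>2 * x ^ (2 * k + 1))
      = 1 / (2 * real k + 1)\<^sup>2 * \<bar>x\<bar> ^ (2 * k + 1)"
    by (simp add: abs_mult power_abs)
  also have "\<dots> \<le> 1 / (2 * real k + 1)\<^sup>2 * 1"
    using x by (intro mult_left_mono power_le_one) auto
  also have "\<dots> \<le> inverse (real (Suc k) ^ 2)"
    by (simp add: inverse_eq_divide frac_le power_mono)
  finally show "norm ((-1) ^ k / (2 * real k + 1)\<^sup>2 * x ^ (2 * k + 1)) \<le> inverse (real (Suc k) ^ 2)" .
qed (auto intro!: always_eventually continuous_intros)

lemma DERIV_inverse_tangent_integral_tan_half:
  assumes "0 < t" "t < pi / 2"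
  shows "((\<lambda>t. 2 * inverse_tangent_integral (tan (t / 2))) has_real_derivative t / sin t) (at t)"
proof -
  have tan_bounds: "0 < tan (t / 2)" "tan (t / 2) < 1"
    using assms tan_gt_zero[of "t / 2"] tan_monotone[of "t / 2" "pi / 4"] by (auto simp: tan_45)
  have cos_pos: "cos (t / 2) > 0" using assms by (intro cos_gt_zero_pi) auto
  have sin_pos: "sin (t / 2) > 0" using assms by (intro sin_gt_zero) auto
  have "((\<lambda>t. 2 * inverse_tangent_integral (tan (t / 2))) has_real_derivative
      2 * (arctan (tan (t / 2)) / tan (t / 2) * (inverse ((cos (t / 2))\<^sup>2) * (1 / 2)))) (at t)"
    using cos_pos tan_bounds
    by (intro DERIV_cmult DERIV_chain2[OF DERIV_inverse_tangent_integral])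
      (auto intro!: derivative_eq_intros)
  also have "arctan (tan (t / 2)) = t / 2"
    using assms by (intro arctan_tan) auto
  also have "2 * (t / 2 / tan (t / 2) * (inverse ((cos (t / 2))\<^sup>2) * (1 / 2))) = t / sin t"
    using sin_pos cos_pos sin_double[of "t / 2"] by (simp add: tan_def field_simps power2_eq_square)
  finally show ?thesis .
qed

lemma has_integral_div_sin_inverse_tangent_integral:
  "((\<lambda>t. t / sin t) has_integral 2 * inverse_tangent_integral 1) {0..pi / 2}"
proof -
  let ?F = "\<lambda>t. 2 * inverse_tangent_integral (tan (t / 2))"
  have "((\<lambda>t. t / sin t) has_integral ?F (pi / 2) - ?F 0) {0..pi / 2}"
  proof (rule fundamental_theorem_of_calculus_interior)
    have half_range: "0 \<le> t / 2" "t / 2 \<le> pi / 4" "t / 2 < pi / 2" if "t \<in> {0..pi / 2}" for t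
      using that pi_gt_zero unfolding atLeastAtMost_iff by linarith+
    then have "tan (t / 2) \<in> {-1..1}" if "t \<in> {0..pi / 2}" for t
      using that tan_mono_le[of 0 "t / 2"] tan_mono_le[of "t / 2" "pi / 4"] by (force simp: tan_45)
    moreover have "cos (t / 2) \<noteq> 0" if "t \<in> {0..pi / 2}" for t
      using half_range[OF that] cos_gt_zero_pi[of "t / 2"] by force
    ultimately show "continuous_on {0..pi / 2} ?F"
      by (intro continuous_intros continuous_on_compose2[OF continuous_on_inverse_tangent_integral])
        auto
  qed (use DERIV_inverse_tangent_integral_tan_half in
        \<open>auto simp flip: has_real_derivative_iff_has_vector_derivative\<close>)
  then show ?thesis
    by (simp add: tan_45 inverse_tangent_integral_def)
qed

lemma dirichlet_L_chi_m1:
  "dirichlet_L s chi_m1 = (\<Sum>k. (-1) ^ k * (2 * real k + 1) powr (-s))"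
proof -
  have double_mono: "strict_mono (\<lambda>j::nat. 2 * j)" by (simp add: strict_mono_def)
  have "dirichlet_L s chi_m1 = (\<Sum>k. chi_m1 (Suc (2 * k)) * real (Suc (2 * k)) powr (-s))"
    unfolding dirichlet_L_def
    by (subst suminf_mono_reindex[OF double_mono, symmetric]) (auto simp: chi_m1_def elim!: evenE)
  then show ?thesis
    by (simp add: chi_m1_def add_ac)
qed

lemma inverse_tangent_integral_1: "inverse_tangent_integral 1 = dirichlet_L 2 chi_m1"
  by (simp add: inverse_tangent_integral_def dirichlet_L_chi_m1 powr_minus_divide)

lemma elliptic_moment_1: "elliptic_moment 1 = 2 * dirichlet_L 2 chi_m1"
  using has_integral_div_sin_elliptic_moment has_integral_div_sin_inverse_tangent_integral
  unfolding has_integral_Icc_iff_Ioo inverse_tangent_integral_1 by (rule has_integral_unique)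

subsection \<open>The recurrence\<close>

lemma apery_like_rec_Suc_Suc:
  assumes "apery_like_rec u"
  shows "(real n + 2)\<^sup>2 * u (Suc (Suc n))
    = (32 * (real n)\<^sup>2 + 96 * real n + 76) * u (Suc n) - 256 * (real n + 1)\<^sup>2 * u n"
  using assms[unfolded apery_like_rec_def, THEN spec, of n] by simp

lemma apery_like_rec_unique:
  assumes "apery_like_rec u" "apery_like_rec v" "u 0 = v 0" "u 1 = v 1"
  shows "u n = v n"
proof (induction n rule: induct_nat_012)
  case (ge2 n)
  have "(real n + 2)\<^sup>2 * u (Suc (Suc n)) = (real n + 2)\<^sup>2 * v (Suc (Suc n))"
    using assms(1,2)[THEN apery_like_rec_Suc_Suc, of n] ge2 by simp
  moreover have "(real n + 2)\<^sup>2 \<noteq> 0" by simp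
  ultimately show ?case by simp
qed (use assms in simp_all)

lemma apery_like_rec_linear:
  assumes "apery_like_rec u" "apery_like_rec v"
  shows "apery_like_rec (\<lambda>n. c * u n + d * v n)"
  unfolding apery_like_rec_def
proof
  fix n
  show "(real n + 2)\<^sup>2 * (c * u (n + 2) + d * v (n + 2))
      - (32 * (real n)\<^sup>2 + 96 * real n + 76) * (c * u (n + 1) + d * v (n + 1))
      + 256 * (real n + 1)\<^sup>2 * (c * u n + d * v n) = 0"
    using assms[THEN apery_like_rec_Suc_Suc, of n] by (simp add: field_simps) algebra
qed

lemma apery_like_rec_casoratian:
  assumes "apery_like_rec u" "apery_like_rec v"
  shows "(real n + 1)\<^sup>2 * (u (Suc n) * v n - u n * v (Suc n)) = 256 ^ n * (u 1 * v 0 - u 0 * v 1)"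
proof (induction n)
  case (Suc n)
  have "(real (Suc n) + 1)\<^sup>2 * (u (Suc (Suc n)) * v (Suc n) - u (Suc n) * v (Suc (Suc n)))
      = (real n + 2)\<^sup>2 * u (Suc (Suc n)) * v (Suc n) - u (Suc n) * ((real n + 2)\<^sup>2 * v (Suc (Suc n)))"
    by (simp add: algebra_simps)
  also have "\<dots> = 256 * ((real n + 1)\<^sup>2 * (u (Suc n) * v n - u n * v (Suc n)))"
    unfolding assms[THEN apery_like_rec_Suc_Suc] by (simp add: algebra_simps)
  finally show ?case unfolding Suc.IH by simp
qed simp

lemma apery_like_rec_quotient_ge_ln:
  assumes "apery_like_rec u" "apery_like_rec v" and pos: "\<And>n. v n > 0"
    and decay: "\<And>n. v n * v (Suc n) \<le> K * 256 ^ n / (real n + 1)"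
    and casoratian: "u 1 * v 0 - u 0 * v 1 = W" and W_nonneg: "W \<ge> 0"
  shows "u 0 / v 0 + W / K * ln (real n + 1) \<le> u n / v n"
proof (induction n)
  case (Suc n)
  let ?x = "real n + 1"
  have prod_pos: "v n * v (Suc n) > 0" by (simp add: pos)
  have "0 < K * 256 ^ n / ?x"
    using prod_pos decay[of n] by (rule less_le_trans)
  then have K_pos: "K > 0" by (simp add: zero_less_mult_iff zero_less_divide_iff)
  have "W / K * ln (real (Suc n) + 1) - W / K * ln ?x \<le> W / K * (1 / ?x)"
    unfolding right_diff_distrib[symmetric]
    using ln_diff_le[of "real (Suc n) + 1" ?x] W_nonneg K_pos
    by (intro mult_left_mono) auto
  also have "\<dots> = 256 ^ n * W / (?x\<^sup>2 * (K * 256 ^ n / ?x))"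
    by (simp add: power2_eq_square)
  also have "\<dots> \<le> 256 ^ n * W / (?x\<^sup>2 * (v n * v (Suc n)))"
    using decay[of n] prod_pos W_nonneg
    by (intro divide_left_mono mult_left_mono mult_pos_pos) (auto simp: K_pos pos)
  also have "\<dots> = u (Suc n) / v (Suc n) - u n / v n"
    using pos[of n] pos[of "Suc n"]
    unfolding apery_like_rec_casoratian[OF assms(1,2), of n, unfolded casoratian, symmetric]
    by (simp add: diff_frac_eq field_simps)
  finally show ?case using Suc.IH by linarith
qed simp

definition recessive_sol :: "nat \<Rightarrow> real" where
  "recessive_sol n = 16 ^ n / 4 * elliptic_moment (real n + 1)"

lemma recessive_sol_0: "recessive_sol 0 = 1 / 2 * dirichlet_L 2 chi_m1"
  by (simp add: recessive_sol_def elliptic_moment_1)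

lemma recessive_sol_1: "recessive_sol 1 = 12 * recessive_sol 0 - 1"
  by (simp add: recessive_sol_def elliptic_moment_2)

lemma recessive_sol_pos: "recessive_sol n > 0"
  by (simp add: recessive_sol_def elliptic_moment_pos)

lemma apery_like_rec_recessive_sol: "apery_like_rec recessive_sol"
  unfolding apery_like_rec_def
proof
  fix n
  have "64 * 16 ^ n * ((real n + 2)\<^sup>2 * elliptic_moment (real n + 3)
      - (2 * (real n + 1)\<^sup>2 + 2 * (real n + 1) + 3 / 4) * elliptic_moment (real n + 2)
      + (real n + 1)\<^sup>2 * elliptic_moment (real n + 1)) = 0"
    using elliptic_moment_op_eq_0[of "real n + 1"] by (simp add: elliptic_moment_op_def add_ac)
  then show "(real n + 2)\<^sup>2 * recessive_sol (n + 2)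
      - (32 * (real n)\<^sup>2 + 96 * real n + 76) * recessive_sol (n + 1)
      + 256 * (real n + 1)\<^sup>2 * recessive_sol n = 0"
    by (simp add: recessive_sol_def power2_eq_square algebra_simps)
qed

lemma recessive_sol_le: "recessive_sol n \<le> 3 / 4 * 16 ^ n / sqrt (real n + 1)"
proof -
  have "elliptic_moment (real n + 1) \<le> pi / 4 * (1 + 1 / (2 * (real n + 1))) * Beta (real n + 1) (1 / 2)"
    by (rule elliptic_moment_le) simp
  also have "\<dots> \<le> 1 * (3 / 2) * (2 / sqrt (real n + 1))"
    using pi_less_4 by (intro mult_mono Beta_half_le) (auto simp: Beta_real_pos less_imp_le field_simps)
  finally have "16 ^ n / 4 * elliptic_moment (real n + 1) \<le> 16 ^ n / 4 * (3 / sqrt (real n + 1))"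
    by (intro mult_left_mono) auto
  then show ?thesis
    by (simp add: recessive_sol_def)
qed

lemma recessive_sol_mult_Suc_le:
  "recessive_sol n * recessive_sol (Suc n) \<le> 9 * 256 ^ n / (real n + 1)"
proof -
  have "recessive_sol n * recessive_sol (Suc n)
      \<le> (3 / 4 * 16 ^ n / sqrt (real n + 1)) * (3 / 4 * 16 ^ Suc n / sqrt (real n + 1))"
  proof (rule mult_mono)
    have "recessive_sol (Suc n) \<le> 3 / 4 * 16 ^ Suc n / sqrt (real (Suc n) + 1)"
      by (rule recessive_sol_le)
    also have "\<dots> \<le> 3 / 4 * 16 ^ Suc n / sqrt (real n + 1)"
      by (intro divide_left_mono) auto
    finally show "recessive_sol (Suc n) \<le> 3 / 4 * 16 ^ Suc n / sqrt (real n + 1)" .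
  qed (use recessive_sol_le[of n] recessive_sol_pos in \<open>auto simp: less_imp_le\<close>)
  also have "\<dots> = 9 * 256 ^ n / (real n + 1)"
    by (simp add: power_mult_distrib[symmetric])
  finally show ?thesis .
qed

lemma recessive_sol_div_le:
  assumes "apery_like_rec u" and "u 0 \<ge> 0" and "n \<ge> 2"
    and casoratian: "u 1 * recessive_sol 0 - u 0 * recessive_sol 1 = W" and W_pos: "W > 0"
  shows "u n > 0" and "recessive_sol n / u n \<le> 9 / (W * ln (real n))"
proof -
  have ln_pos: "W / 9 * ln (real n) > 0"
    using W_pos \<open>n \<ge> 2\<close> by simp
  have "W / 9 * ln (real n) \<le> u 0 / recessive_sol 0 + W / 9 * ln (real n + 1)"
    using assms recessive_sol_pos[of 0] by (intro add_increasing mult_left_mono) auto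
  also have "\<dots> \<le> u n / recessive_sol n"
    using apery_like_rec_quotient_ge_ln[OF assms(1) apery_like_rec_recessive_sol recessive_sol_pos
        recessive_sol_mult_Suc_le casoratian] W_pos by simp
  finally have lower: "W / 9 * ln (real n) \<le> u n / recessive_sol n" .
  with ln_pos have "u n / recessive_sol n > 0"
    by linarith
  then show "u n > 0"
    using recessive_sol_pos[of n] by (simp add: zero_less_divide_iff)
  show "recessive_sol n / u n \<le> 9 / (W * ln (real n))"
    using le_imp_inverse_le[OF lower ln_pos] by simp
qed

theorem theorem3:
  fixes a b :: "nat \<Rightarrow> real"
  assumes "apery_like_rec a" and "a 0 = 1" and "a 1 = 12"
    and "apery_like_rec b" and "b 0 = 0" and "b 1 = 1"
  shows "(\<lambda>n. \<bar>b n / a n - 1 / 2 * dirichlet_L 2 chi_m1\<bar>) \<in> O(\<lambda>n. 1 / ln (real n))"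
proof (rule bigoI[where c = 9], rule eventually_sequentiallyI[of 2])
  fix n :: nat assume "n \<ge> 2"
  let ?q = recessive_sol
  have "b n = ?q 0 * a n + (-1) * ?q n"
    by (rule apery_like_rec_unique[OF assms(4)
          apery_like_rec_linear[OF assms(1) apery_like_rec_recessive_sol]])
      (use assms(2,3,5,6) recessive_sol_1 in simp_all)
  moreover have "a 1 * ?q 0 - a 0 * ?q 1 = 1"
    using assms(2,3) recessive_sol_1 by simp
  then have "a n > 0" and "?q n / a n \<le> 9 / ln (real n)"
    using recessive_sol_div_le[OF assms(1) _ \<open>n \<ge> 2\<close>] assms(2) by simp_all
  ultimately have "\<bar>b n / a n - ?q 0\<bar> \<le> 9 / ln (real n)"
    using recessive_sol_pos[of n] by (simp add: diff_divide_distrib)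
  then show "norm \<bar>b n / a n - 1 / 2 * dirichlet_L 2 chi_m1\<bar> \<le> 9 * norm (1 / ln (real n))"
    using \<open>n \<ge> 2\<close> by (simp add: recessive_sol_0)
qed

end
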